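(* Let $\bar\kappa$ be a Markov kernel on $\Omega=[0,1]$ with $\sup_{x\in\Omega}V_u(\bar\kappa(x,u))<\infty$, and let $p\in\mathbf{D}$ be the stationary distribution of the corresponding Markov chain (the original MC), i.e. $p(x)=\int_\Omega\bar\kappa(x,u)\,dp(u)$ for all $x\in\Omega$. Let an approximate finite-state Markov chain have states $0=c_1<c_2<\dots<c_J=1$ and transition matrix $Q=\{q_{ij}\}_{i,j=1,\dots,J}$, and let $p'\in\mathbf{D}$ be the distribution function of its stationary distribution. Put $c_0:=-\infty$ and $$\bar\kappa'(x,u):=\sum_{i=1}^{J}\Big(\sum_{j=1}^{J}\mathbf{1}\{c_j\le x\}\,q_{ij}\Big)\mathbf{1}\{u\in(c_{i-1},c_i]\},\qquad x,u\in\Omega .$$ If the approximate Markov chain is irreducible, then $$\|p-p'\|_\infty\le e_1\cdot e_2,$$ where $e_1=\sup_{x,u\in\Omega}|\bar\kappa(x,u)-\bar\kappa'(x,u)|$, $e_2^{-1}=\min_{k=0,1,\dots,J}\{y_k^*\}$, and, for each $k=0,1,\dots,J$, $y_k^*$ is the optimal value of the linear program (with $a_0\equiv 0$) $$\min_{y_k\in\mathbb{R},\ \{a_j\}_{j=1}^{J}\in[-1,1]^{J}}\ y_k$$ subject to $$-y_k\le a_j+\eta\,\delta_{jk}(1-a_j)-\sum_{i=1}^{J}\Big(1+\sum_{s=1}^{j}q_{is}\Big)(a_i-a_{i-1})\le y_k,\qquad j=0,1,\dots,J,\ \eta\in\{0,1\}.$$ (For $j=0$ the inner sum is empty; $\delta_{jk}$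 is the Kronecker delta.)
   Context: $\Omega=[0,1]$ and $\mathcal{B}$ is its Borel $\sigma$-algebra. $\mathbf{D}$ is the set of (right-continuous) distribution functions of probability measures on $(\Omega,\mathcal{B})$, viewed as functions on $\mathbb{R}$ vanishing for $x<0$ and equal to $1$ for $x\ge 1$. $\|\cdot\|_\infty$ is the supremum norm. For $f\in\mathbf{D}$, $\int_\Omega g\,df$ is the integral of $g$ against the measure on $\Omega$ with distribution function $f$ (including a possible atom at $0$). A Markov kernel is a function $\bar\kappa:\Omega^2\to\mathbb{R}_+$ such that $\bar\kappa(x,\cdot)$ is $\mathcal{B}$-measurable for every $x\in\Omega$ and $\bar\kappa(\cdot,u)\in\mathbf{D}$ for every $u\in\Omega$ ($\bar\kappa(x,u)$ is the probability of moving from state $u$ to a state $\le x$). $V_u(\bar\kappa(x,u))$ denotes the total variation over $\Omega$ of $u\mapsto\bar\kappa(x,u)$ for fixed $x$. $q_{ij}$ is the probability of moving from $c_i$ to $c_j$. *)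

theory Defs
  imports "HOL-Probability.Probability"
begin

section \<open>Distribution functions and Markov kernels on the unit interval\<close>

abbreviation Omega :: "real set" (\<open>\<Omega>\<close>) where
  "\<Omega> \<equiv> {0..1}"

text \<open>
  The push-forward to the real line makes these functions on all of \<open>\<real>\<close>, which
  are \<open>0\<close> for \<open>x < 0\<close> and \<open>1\<close> for \<open>x \<ge> 1\<close>.
\<close>

definition dist_funs :: "(real \<Rightarrow> real) set" where
  "dist_funs = {cdf (distr M borel id) | M.
     prob_space M \<and> sets M = sets (restrict_space borel \<Omega>)}"

definition sup_norm :: "(real \<Rightarrow> real) \<Rightarrow> real" where
  "sup_norm f = (SUP x. \<bar>f x\<bar>)"

text \<open>
  The library's \<^const>\<open>interval_measure\<close> is the Lebesgue-Stieltjes measure on the whole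
  line. As a distribution function on \<open>\<Omega>\<close> vanishes to the left of \<open>0\<close>, a jump at \<open>0\<close> yields
  an atom at \<open>0\<close>, which is included in the integral.
\<close>

definition stieltjes_integral :: "(real \<Rightarrow> real) \<Rightarrow> (real \<Rightarrow> real) \<Rightarrow> real" where
  "stieltjes_integral g f = (LINT u:\<Omega>|interval_measure f. g u)"

text \<open>
  \<open>\<kappa> x u\<close> is the probability of moving from state \<open>u\<close> to a state \<open>\<le> x\<close>. For \<open>u \<in> \<Omega>\<close>,
  membership of \<open>\<lambda>x. \<kappa> x u\<close> in \<^const>\<open>dist_funs\<close> also fixes the values at \<open>x \<notin> \<Omega>\<close>; nothing
  is said about \<open>u \<notin> \<Omega>\<close>.
\<close>

definition markov_kernel :: "(real \<Rightarrow> real \<Rightarrow> real) \<Rightarrow> bool" where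
  "markov_kernel \<kappa> \<longleftrightarrow>
     (\<forall>x\<in>\<Omega>. \<forall>u\<in>\<Omega>. 0 \<le> \<kappa> x u) \<and>
     (\<forall>x\<in>\<Omega>. \<kappa> x \<in> borel_measurable (restrict_space borel \<Omega>)) \<and>
     (\<forall>u\<in>\<Omega>. (\<lambda>x. \<kappa> x u) \<in> dist_funs)"

definition stationary_df :: "(real \<Rightarrow> real \<Rightarrow> real) \<Rightarrow> (real \<Rightarrow> real) \<Rightarrow> bool" where
  "stationary_df \<kappa> p \<longleftrightarrow>
     p \<in> dist_funs \<and> (\<forall>x\<in>\<Omega>. p x = stieltjes_integral (\<kappa> x) p)"

definition total_variation :: "(real \<Rightarrow> real) \<Rightarrow> real \<Rightarrow> real \<Rightarrow> ennreal" where
  "total_variation f a b =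
     (SUP (n, t) \<in> {(n :: nat, t :: nat \<Rightarrow> real).
          t 0 = a \<and> t n = b \<and> (\<forall>i<n. t i \<le> t (Suc i))}.
        \<Sum>i<n. ennreal \<bar>f (t (Suc i)) - f (t i)\<bar>)"


section \<open>Finite-state Markov chains\<close>

text \<open>
  The states are numbered by \<open>{1..J}\<close>; \<open>Q i j\<close> is the probability of moving from the
  \<open>i\<close>-th to the \<open>j\<close>-th state. Values at other indices are irrelevant throughout.
\<close>

definition transition_matrix :: "nat \<Rightarrow> (nat \<Rightarrow> nat \<Rightarrow> real) \<Rightarrow> bool" where
  "transition_matrix J Q \<longleftrightarrow>
     (\<forall>i\<in>{1..J}. (\<forall>j\<in>{1..J}. 0 \<le> Q i j) \<and> (\<Sum>j=1..J. Q i j) = 1)"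

primrec n_step :: "nat \<Rightarrow> (nat \<Rightarrow> nat \<Rightarrow> real) \<Rightarrow> nat \<Rightarrow> nat \<Rightarrow> nat \<Rightarrow> real" where
  "n_step J Q 0 i j = of_bool (i = j)"
| "n_step J Q (Suc n) i j = (\<Sum>s=1..J. n_step J Q n i s * Q s j)"

definition irreducible_chain :: "nat \<Rightarrow> (nat \<Rightarrow> nat \<Rightarrow> real) \<Rightarrow> bool" where
  "irreducible_chain J Q \<longleftrightarrow> (\<forall>i\<in>{1..J}. \<forall>j\<in>{1..J}. \<exists>n. 0 < n_step J Q n i j)"

definition stationary_vector :: "nat \<Rightarrow> (nat \<Rightarrow> nat \<Rightarrow> real) \<Rightarrow> (nat \<Rightarrow> real) \<Rightarrow> bool" where
  "stationary_vector J Q \<pi> \<longleftrightarrow>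
     (\<forall>i\<in>{1..J}. 0 \<le> \<pi> i) \<and> (\<Sum>i=1..J. \<pi> i) = 1 \<and>
     (\<forall>j\<in>{1..J}. \<pi> j = (\<Sum>i=1..J. \<pi> i * Q i j))"

definition discrete_df :: "nat \<Rightarrow> (nat \<Rightarrow> real) \<Rightarrow> (nat \<Rightarrow> real) \<Rightarrow> real \<Rightarrow> real" where
  "discrete_df J c \<pi> x = (\<Sum>j=1..J. of_bool (c j \<le> x) * \<pi> j)"

definition grid :: "nat \<Rightarrow> (nat \<Rightarrow> real) \<Rightarrow> bool" where
  "grid J c \<longleftrightarrow> 2 \<le> J \<and> c 1 = 0 \<and> c J = 1 \<and> strict_mono_on {1..J} c"

text \<open>The convention \<open>c\<^sub>0 = -\<infinity>\<close>; the real number \<open>c 0\<close> is never used.\<close>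

definition cut :: "(nat \<Rightarrow> real) \<Rightarrow> nat \<Rightarrow> ereal" where
  "cut c i = (if i = 0 then -\<infinity> else ereal (c i))"

definition approx_kernel ::
  "nat \<Rightarrow> (nat \<Rightarrow> real) \<Rightarrow> (nat \<Rightarrow> nat \<Rightarrow> real) \<Rightarrow> real \<Rightarrow> real \<Rightarrow> real" where
  "approx_kernel J c Q x u =
     (\<Sum>i=1..J. (\<Sum>j=1..J. of_bool (c j \<le> x) * Q i j) *
        indicator {cut c (i - 1)<..cut c i} (ereal u))"


section \<open>The two factors of the error bound\<close>

definition kernel_error ::
  "(real \<Rightarrow> real \<Rightarrow> real) \<Rightarrow> (real \<Rightarrow> real \<Rightarrow> real) \<Rightarrow> real" where
  "kernel_error \<kappa> \<kappa>' = (SUP (x, u) \<in> \<Omega> \<times> \<Omega>. \<bar>\<kappa> x u - \<kappa>' x u\<bar>)"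

definition lp_feasible ::
  "nat \<Rightarrow> (nat \<Rightarrow> nat \<Rightarrow> real) \<Rightarrow> nat \<Rightarrow> real \<Rightarrow> (nat \<Rightarrow> real) \<Rightarrow> bool" where
  "lp_feasible J Q k y a \<longleftrightarrow>
     a 0 = 0 \<and> (\<forall>j\<in>{1..J}. a j \<in> {-1..1}) \<and>
     (\<forall>j\<in>{0..J}. \<forall>\<eta>\<in>{0, 1}.
        (let r = a j + \<eta> * of_bool (j = k) * (1 - a j)
                 - (\<Sum>i=1..J. (1 + (\<Sum>s=1..j. Q i s)) * (a i - a (i - 1)))
         in -y \<le> r \<and> r \<le> y))"

text \<open>
  The program is feasible (take \<open>a = 0\<close> and \<open>y = 1\<close>) and its objective is bounded below
  by \<open>0\<close>, so the infimum over the reals is its optimal value.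
\<close>

definition lp_value :: "nat \<Rightarrow> (nat \<Rightarrow> nat \<Rightarrow> real) \<Rightarrow> nat \<Rightarrow> real" where
  "lp_value J Q k = Inf {y. \<exists>a. lp_feasible J Q k y a}"

definition stability_factor :: "nat \<Rightarrow> (nat \<Rightarrow> nat \<Rightarrow> real) \<Rightarrow> real" where
  "stability_factor J Q = inverse (Min (lp_value J Q ` {0..J}))"

end

(* Both stationarity equations give, for the difference d of the two distribution functions, a
   discrete equation d(x) = sum_i K_i(x) (d(c_i) - d(c_{i-1})) up to an error e_1. If |d| almost
   attains its supremum D at a point x of [c_k, c_{k+1}), then the numbers d(c_j)/D, multiplied by
   the sign of d(x), are feasible for the k-th linear program with an objective close to e_1/D; the
   constraint with eta = 1 expresses the equation at x, where the normalised difference is close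
   to 1. Hence D times the least optimal value is at most e_1. Irreducibility makes that value
   positive: at objective 0 the increments of a would form an invariant vector of total mass 0,
   hence vanish, although a_k = 1. *)

theory Submission
  imports Defs
begin

section \<open>Invariant vectors of an irreducible chain\<close>

lemma invariant_n_step:
  assumes "\<And>j. j \<in> {1..J} \<Longrightarrow> v j = (\<Sum>i=1..J. v i * Q i j)" and "j \<in> {1..J}"
  shows "v j = (\<Sum>i=1..J. v i * n_step J Q n i j)"
  using assms(2)
proof (induction n arbitrary: j)
  case 0
  have "(\<Sum>i=1..J. v i * n_step J Q 0 i j) = (\<Sum>i=1..J. if i = j then v i else 0)"
    by (intro sum.cong) auto
  with 0 show ?case by simp
next
  case (Suc n)
  have "v j = (\<Sum>s=1..J. (\<Sum>i=1..J. v i * n_step J Q n i s) * Q s j)"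
    unfolding assms(1)[OF Suc.prems]
    by (intro sum.cong refl arg_cong2[where f = times] Suc.IH)
  also have "\<dots> = (\<Sum>i=1..J. v i * n_step J Q (Suc n) i j)"
    by (simp add: sum_distrib_left sum_distrib_right mult.assoc) (rule sum.swap)
  finally show ?case .
qed

lemma n_step_nonneg:
  assumes "transition_matrix J Q" and "i \<in> {1..J}" and "j \<in> {1..J}"
  shows "0 \<le> n_step J Q n i j"
  using assms(3)
  by (induction n arbitrary: j)
     (use assms in \<open>auto simp: transition_matrix_def intro!: sum_nonneg mult_nonneg_nonneg\<close>)

text \<open>Invariance under all powers of \<open>Q\<close> writes \<open>v j = 0\<close> as a sum
  of nonnegative terms \<open>v i * n_step J Q n i j\<close>. All of them vanish, and irreducibility
  provides an \<open>n\<close> for which the factor of \<open>v i\<close> is positive.\<close>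

lemma nonneg_invariant_vanishes:
  assumes Q: "transition_matrix J Q" and irr: "irreducible_chain J Q"
    and inv: "\<And>j. j \<in> {1..J} \<Longrightarrow> v j = (\<Sum>i=1..J. v i * Q i j)"
    and nonneg: "\<And>j. j \<in> {1..J} \<Longrightarrow> 0 \<le> v j"
    and j: "j \<in> {1..J}" "v j = 0" and i: "i \<in> {1..J}"
  shows "v i = 0"
proof -
  obtain n where n: "0 < n_step J Q n i j"
    using irr i j(1) unfolding irreducible_chain_def by blast
  have "(\<Sum>i=1..J. v i * n_step J Q n i j) = 0"
    using invariant_n_step[OF inv j(1), of n] j(2) by simp
  then have "v i * n_step J Q n i j = 0"
    using i j n_step_nonneg[OF Q] nonneg
    by (subst (asm) sum_nonneg_eq_0_iff) auto
  with n show ?thesis by simp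
qed

text \<open>If \<open>v\<close> is invariant, then so is \<open>\<bar>v\<bar>\<close>: the triangle inequality gives
  \<open>\<bar>v\<bar> \<le> \<bar>v\<bar> Q\<close>, and both sides have the same total mass. Hence \<open>\<bar>v\<bar> + v\<close> is
  nonnegative, invariant, and vanishes where \<open>v \<le> 0\<close>.\<close>

lemma zero_sum_invariant_vanishes:
  assumes Q: "transition_matrix J Q" and irr: "irreducible_chain J Q"
    and inv: "\<And>j. j \<in> {1..J} \<Longrightarrow> v j = (\<Sum>i=1..J. v i * Q i j)"
    and sum0: "(\<Sum>i=1..J. v i) = 0" and i: "i \<in> {1..J}"
  shows "v i = 0"
proof -
  have le: "\<bar>v j\<bar> \<le> (\<Sum>i=1..J. \<bar>v i\<bar> * Q i j)" if "j \<in> {1..J}" for j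
  proof -
    have "\<bar>v j\<bar> \<le> (\<Sum>i=1..J. \<bar>v i * Q i j\<bar>)"
      using inv[OF that] sum_abs[of "\<lambda>i. v i * Q i j" "{1..J}"] by simp
    also have "\<dots> = (\<Sum>i=1..J. \<bar>v i\<bar> * Q i j)"
      using Q that by (intro sum.cong) (auto simp: transition_matrix_def abs_mult)
    finally show ?thesis .
  qed
  have "(\<Sum>j=1..J. \<Sum>i=1..J. \<bar>v i\<bar> * Q i j) = (\<Sum>i=1..J. \<bar>v i\<bar> * (\<Sum>j=1..J. Q i j))"
    by (simp add: sum_distrib_left) (rule sum.swap)
  also have "\<dots> = (\<Sum>i=1..J. \<bar>v i\<bar>)"
    using Q by (intro sum.cong) (auto simp: transition_matrix_def)
  finally have "(\<Sum>j=1..J. (\<Sum>i=1..J. \<bar>v i\<bar> * Q i j) - \<bar>v j\<bar>) = 0"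
    by (simp add: sum_subtractf)
  then have abs_inv: "\<bar>v j\<bar> = (\<Sum>i=1..J. \<bar>v i\<bar> * Q i j)" if "j \<in> {1..J}" for j
    using that le by (subst (asm) sum_nonneg_eq_0_iff) auto
  have "\<exists>j\<in>{1..J}. v j \<le> 0"
  proof (rule ccontr)
    assume "\<not> ?thesis"
    then have "0 < (\<Sum>i=1..J. v i)"
      using i by (intro sum_pos) (auto simp: not_le)
    with sum0 show False by simp
  qed
  then obtain j where j: "j \<in> {1..J}" "v j \<le> 0" by blast
  have "\<bar>v k\<bar> + v k = 0" if "k \<in> {1..J}" for k
  proof (rule nonneg_invariant_vanishes[OF Q irr, where v = "\<lambda>i. \<bar>v i\<bar> + v i"])
    show "\<bar>v j\<bar> + v j = (\<Sum>i=1..J. (\<bar>v i\<bar> + v i) * Q i j)" if "j \<in> {1..J}" for j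
      using abs_inv[OF that] inv[OF that] by (simp add: distrib_right sum.distrib)
  qed (use j that in auto)
  then have "v k \<le> 0" if "k \<in> {1..J}" for k using that by force
  \<comment> \<open>Now \<open>- v\<close> is nonnegative with total mass 0.\<close>
  then have "\<forall>k\<in>{1..J}. v k = 0"
    using sum0 sum_nonneg_eq_0_iff[of "{1..J}" "\<lambda>i. - v i"] by (auto simp: sum_negf)
  with i show ?thesis by blast
qed

section \<open>Positivity of the linear programs\<close>

text \<open>The expression between the bounds of the linear program, where \<open>t\<close> stands
  for \<open>a j + \<eta> * of_bool (j = k) * (1 - a j)\<close>. This term is 1 if
  \<open>\<eta> = 1\<close> and \<open>j = k\<close>, and \<open>a j\<close> otherwise.\<close>

definition residual :: "nat \<Rightarrow> (nat \<Rightarrow> nat \<Rightarrow> real) \<Rightarrow> (nat \<Rightarrow> real) \<Rightarrow> nat \<Rightarrow> real \<Rightarrow> real" where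
  "residual J Q a j t = t - (\<Sum>i=1..J. (1 + (\<Sum>s=1..j. Q i s)) * (a i - a (i - 1)))"

lemma lp_feasible_iff:
  "lp_feasible J Q k y a \<longleftrightarrow>
     a 0 = 0 \<and> (\<forall>j\<in>{1..J}. \<bar>a j\<bar> \<le> 1) \<and>
     (\<forall>j\<in>{0..J}. \<bar>residual J Q a j (a j)\<bar> \<le> y) \<and> (k \<in> {0..J} \<longrightarrow> \<bar>residual J Q a k 1\<bar> \<le> y)"
  unfolding lp_feasible_def residual_def Let_def abs_le_iff
  by (auto simp: minus_le_iff)

lemma sum_increments:
  fixes a :: "nat \<Rightarrow> real"
  shows "(\<Sum>i=1..n. a i - a (i - 1)) = a n - a 0"
  by (induction n) auto

text \<open>The unit weights telescope to \<open>a J\<close>. In particular the constraint for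
  \<open>j = 0\<close>, whose inner sums are empty, bounds \<open>\<bar>a J\<bar>\<close>.\<close>

lemma residual_unit_split:
  assumes "a 0 = 0"
  shows "residual J Q a j t = t - a J - (\<Sum>i=1..J. (\<Sum>s=1..j. Q i s) * (a i - a (i - 1)))"
  using sum_increments[of a J] assms by (simp add: residual_def distrib_right sum.distrib)

text \<open>Index 0 forces \<open>a J = 0\<close>, so the increments of \<open>a\<close> have total
  mass 0. Differencing the remaining equations in \<open>j\<close> shows that they form an invariant
  vector, so they vanish and \<open>a = 0\<close> up to index \<open>J\<close>. But the two
  residuals at \<open>k\<close> differ by \<open>1 - a k\<close>, which forces
  \<open>a k = 1\<close>.\<close>

lemma residuals_not_all_zero:
  assumes Q: "transition_matrix J Q" and irr: "irreducible_chain J Q" and "k \<le> J" and a0: "a 0 = 0"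
    and res: "\<And>j. j \<le> J \<Longrightarrow> residual J Q a j (a j) = 0"
  shows "residual J Q a k 1 \<noteq> 0"
proof
  assume "residual J Q a k 1 = 0"
  with res[OF \<open>k \<le> J\<close>] have ak: "a k = 1" by (simp add: residual_def)
  define b where "b i = a i - a (i - 1)" for i
  have aJ: "a J = 0"
    using res[of 0] a0 by (simp add: residual_unit_split)
  have eq: "a j = (\<Sum>i=1..J. (\<Sum>s=1..j. Q i s) * b i)" if "j \<le> J" for j
    using res[OF that] a0 aJ by (simp add: residual_unit_split b_def)
  have "b i = 0" if "i \<in> {1..J}" for i
  proof (rule zero_sum_invariant_vanishes[OF Q irr _ _ that])
    show "b j = (\<Sum>i=1..J. b i * Q i j)" if j: "j \<in> {1..J}" for j
    proof -
      \<comment> \<open>Here \<open>j'\<close> may be 0: \<open>eq\<close> includes this index, so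
        the first increment needs no separate argument.\<close>
      obtain j' where j': "j = Suc j'" using j by (cases j) auto
      have "b j = (\<Sum>i=1..J. (\<Sum>s=1..j. Q i s) * b i) - (\<Sum>i=1..J. (\<Sum>s=1..j'. Q i s) * b i)"
        using eq[of j, symmetric] eq[of j', symmetric] j j' by (simp add: b_def[of "Suc j'"] del: sum.cl_ivl_Suc)
      also have "\<dots> = (\<Sum>i=1..J. b i * Q i j)"
        unfolding sum_subtractf[symmetric] j' by (intro sum.cong) (auto simp: algebra_simps)
      finally show ?thesis .
    qed
    show "(\<Sum>i=1..J. b i) = 0"
      using sum_increments[of a J] a0 aJ by (simp add: b_def)
  qed
  then have "a k = 0" using sum_increments[of a k] a0 \<open>k \<le> J\<close> by (simp add: b_def)
  with ak show False by simp
qed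

text \<open>By compactness, the sum \<open>F\<close> of the absolute residuals attains its minimum,
  which is positive by \<open>residuals_not_all_zero\<close>. Each of the \<open>J + 2\<close>
  summands is at most \<open>y\<close> at a feasible point, so \<open>y\<close> is at least the
  minimum divided by \<open>J + 2\<close>.\<close>

lemma lp_value_pos:
  assumes Q: "transition_matrix J Q" and irr: "irreducible_chain J Q" and k: "k \<le> J"
  shows "0 < lp_value J Q k"
proof -
  \<comment> \<open>Fixing the coordinates outside \<open>{1..J}\<close> at 0 makes the cube a
    compact product in the space of all sequences.\<close>
  define A :: "(nat \<Rightarrow> real) set"
    where "A = (\<Pi>\<^sub>E j\<in>UNIV. if j \<in> {1..J} then {-1..1} else {0})"
  define F where "F a = \<bar>residual J Q a k 1\<bar> + (\<Sum>j=0..J. \<bar>residual J Q a j (a j)\<bar>)" for a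
  have "compactin (product_topology (\<lambda>i. euclidean) UNIV) A"
    unfolding A_def by (subst compactin_PiE) auto
  then have cpt: "compact A"
    by (simp add: euclidean_product_topology)
  have "continuous_on UNIV F"
    unfolding F_def residual_def by (intro continuous_intros continuous_on_product_coordinates)
  then have cont: "continuous_on A F" by (rule continuous_on_subset) simp
  have "(\<lambda>_. 0) \<in> A" by (auto simp: A_def)
  then obtain m where m: "m \<in> A" "\<And>a. a \<in> A \<Longrightarrow> F m \<le> F a"
    using continuous_attains_inf[OF cpt _ cont] by blast
  have "0 < F m"
  proof (rule ccontr)
    assume "\<not> 0 < F m"
    moreover have "0 \<le> (\<Sum>j=0..J. \<bar>residual J Q m j (m j)\<bar>)" by (intro sum_nonneg) auto
    ultimately have *: "residual J Q m k 1 = 0" "(\<Sum>j=0..J. \<bar>residual J Q m j (m j)\<bar>) = 0"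
      unfolding F_def by linarith+
    then have "residual J Q m j (m j) = 0" if "j \<le> J" for j
      using that by (subst (asm) sum_nonneg_eq_0_iff) auto
    moreover have "m 0 = 0" using m(1) by (auto simp: A_def PiE_iff dest: spec[of _ 0])
    ultimately show False using residuals_not_all_zero[OF Q irr k] * by blast
  qed
  have low: "F m / (J + 2) \<le> y" if feas: "lp_feasible J Q k y a" for y a
  proof -
    \<comment> \<open>Feasibility leaves the entries beyond \<open>J\<close> free; cutting them off
      leads into \<open>A\<close> and keeps the residuals.\<close>
    define a' where "a' j = (if j \<in> {1..J} then a j else 0)" for j
    have a0: "a 0 = 0" and a1: "\<And>j. j \<in> {1..J} \<Longrightarrow> \<bar>a j\<bar> \<le> 1"
      using feas by (auto simp: lp_feasible_iff)
    have "a' \<in> A" using a1 by (auto simp: A_def a'_def abs_le_iff)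
    have *: "a' j = a j" if "j \<le> J" for j using that a0 by (cases j) (auto simp: a'_def)
    have **: "residual J Q a' j t = residual J Q a j t" for j t
      unfolding residual_def by (intro arg_cong2[where f = minus] sum.cong refl) (auto simp: *)
    have "F a' = \<bar>residual J Q a k 1\<bar> + (\<Sum>j=0..J. \<bar>residual J Q a j (a j)\<bar>)"
      by (simp add: F_def * **)
    also have "\<dots> \<le> y + (\<Sum>j=0..J. y)"
      using feas k by (intro add_mono sum_mono) (auto simp: lp_feasible_iff)
    finally have "F m \<le> (J + 2) * y" using m(2)[OF \<open>a' \<in> A\<close>] by (simp add: algebra_simps)
    then show ?thesis by (simp add: field_simps)
  qed
  have "lp_feasible J Q k 1 (\<lambda>_. 0)"
    by (simp add: lp_feasible_iff residual_def)
  then have "F m / (J + 2) \<le> lp_value J Q k"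
    unfolding lp_value_def by (intro cInf_greatest) (use low in auto)
  moreover have "0 < F m / (J + 2)" using \<open>0 < F m\<close> by simp
  ultimately show ?thesis by linarith
qed

lemma lp_value_le:
  assumes "lp_feasible J Q k y a"
  shows "lp_value J Q k \<le> y"
  unfolding lp_value_def
proof (rule cInf_lower)
  show "bdd_below {y. \<exists>a. lp_feasible J Q k y a}"
    by (rule bdd_belowI[of _ 0]) (force simp: lp_feasible_iff)
qed (use assms in blast)

section \<open>Distribution functions on the unit interval\<close>

text \<open>A distribution on the line is determined by its distribution function, so
  \<open>interval_measure f\<close> is the push-forward from which \<open>f\<close> arose, a
  probability measure carried by \<open>\<Omega>\<close>.\<close>

lemma dist_funsE:
  assumes "f \<in> dist_funs"
  obtains N where "real_distribution N" "interval_measure f = N" "cdf N = f" "measure N \<Omega> = 1"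
proof -
  obtain M where M: "prob_space M" "sets M = sets (restrict_space borel \<Omega>)"
    and f: "f = cdf (distr M borel id)"
    using assms by (auto simp: dist_funs_def)
  interpret prob_space M by fact
  let ?N = "distr M borel (id :: real \<Rightarrow> real)"
  have space: "space M = \<Omega>"
    using sets_eq_imp_space_eq[OF M(2)] by (simp add: space_restrict_space)
  have id: "id \<in> measurable M borel"
    unfolding measurable_cong_sets[OF M(2) refl] id_def
    by (intro measurable_restrict_space1 measurable_ident_sets refl)
  have rd: "real_distribution ?N"
    using id by (intro real_distribution_distr) auto
  have "measure ?N \<Omega> = measure M (space M)"
    using id by (simp add: measure_distr space)
  then have "measure ?N \<Omega> = 1" by (simp add: prob_space)
  moreover have "interval_measure f = ?N"
  proof (rule cdf_unique)
    interpret N: real_distribution ?N by fact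
    have mono: "\<And>x y. x \<le> y \<Longrightarrow> f x \<le> f y" and rc: "\<And>a. continuous (at_right a) f"
      and bot: "(f \<longlongrightarrow> 0) at_bot" and top: "(f \<longlongrightarrow> 1) at_top"
      using N.cdf_nondecreasing N.cdf_is_right_cont N.cdf_lim_at_bot N.cdf_lim_at_top_prob
      by (auto simp: f)
    show "real_distribution (interval_measure f)"
      by (rule real_distribution_interval_measure[OF mono rc bot top])
    show "cdf (interval_measure f) = cdf ?N"
      using cdf_interval_measure[OF mono rc bot] by (simp add: f)
  qed (rule rd)
  ultimately show ?thesis using that rd f by blast
qed

lemma dist_funs_bounds:
  assumes "f \<in> dist_funs"
  shows "0 \<le> f x" and "f x \<le> 1" and "x < 0 \<Longrightarrow> f x = 0" and "1 \<le> x \<Longrightarrow> f x = 1"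
proof -
  obtain N where N: "real_distribution N" "cdf N = f" "measure N \<Omega> = 1"
    using dist_funsE[OF assms] by metis
  interpret N: real_distribution N by fact
  show "0 \<le> f x" "f x \<le> 1"
    using N.cdf_nonneg N.cdf_bounded_prob by (auto simp flip: N(2))
  show "f x = 0" if "x < 0"
  proof -
    have "measure N ({..x} \<union> \<Omega>) = measure N {..x} + measure N \<Omega>"
      using that by (intro N.finite_measure_Union) auto
    then show ?thesis
      using N.prob_le_1[of "{..x} \<union> \<Omega>"] N(3) measure_nonneg[of N "{..x}"]
      by (simp flip: N(2) add: cdf_def)
  qed
  show "f x = 1" if "1 \<le> x"
  proof -
    have "measure N \<Omega> \<le> measure N {..x}"
      using that by (intro N.finite_measure_mono) auto
    then show ?thesis
      using N.prob_le_1[of "{..x}"] N(3) by (simp flip: N(2) add: cdf_def)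
  qed
qed

section \<open>The error equation\<close>

text \<open>The distribution function of the \<open>i\<close>-th row of \<open>Q\<close>, which is
  the value of the approximate kernel for \<open>u\<close> in the \<open>i\<close>-th cell.\<close>

definition row_df :: "nat \<Rightarrow> (nat \<Rightarrow> real) \<Rightarrow> (nat \<Rightarrow> nat \<Rightarrow> real) \<Rightarrow> real \<Rightarrow> nat \<Rightarrow> real" where
  "row_df J c Q x i = (\<Sum>j=1..J. of_bool (c j \<le> x) * Q i j)"

text \<open>Real form of the intervals between the cuts; the convention
  \<open>c\<^sub>0 = -\<infinity>\<close> makes the first one a half-line.\<close>

definition cell :: "(nat \<Rightarrow> real) \<Rightarrow> nat \<Rightarrow> real set" where
  "cell c i = (if i = 1 then {..c 1} else {c (i - 1)<..c i})"

lemma approx_kernel_eq: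
  "approx_kernel J c Q x u = (\<Sum>i=1..J. row_df J c Q x i * indicator (cell c i) u)"
  unfolding approx_kernel_def row_df_def
  by (intro sum.cong refl arg_cong2[where f = times])
     (auto simp: cell_def cut_def indicator_def)

lemma cell_borel [measurable]: "cell c i \<in> sets borel"
  by (simp add: cell_def)

lemma row_df_bounds:
  assumes "transition_matrix J Q" and "i \<in> {1..J}"
  shows "0 \<le> row_df J c Q x i" and "row_df J c Q x i \<le> 1"
proof -
  show "0 \<le> row_df J c Q x i"
    using assms by (auto simp: row_df_def transition_matrix_def intro!: sum_nonneg)
  have "row_df J c Q x i \<le> (\<Sum>j=1..J. Q i j)"
    unfolding row_df_def using assms by (intro sum_mono) (auto simp: transition_matrix_def)
  with assms show "row_df J c Q x i \<le> 1" by (simp add: transition_matrix_def)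
qed

text \<open>The largest index of a state \<open>\<le> x\<close> serves as \<open>k\<close>; state 1
  qualifies because \<open>c 1 = 0\<close>.\<close>

lemma grid_index:
  assumes "grid J c" and "0 \<le> x"
  obtains k where "k \<in> {1..J}" "\<And>j. j \<in> {1..J} \<Longrightarrow> c j \<le> x \<longleftrightarrow> j \<le> k"
proof -
  let ?S = "{j \<in> {1..J}. c j \<le> x}"
  have "1 \<in> ?S" using assms by (auto simp: grid_def)
  then have k: "Max ?S \<in> ?S" by (intro Max_in) auto
  have "c j \<le> x \<longleftrightarrow> j \<le> Max ?S" if j: "j \<in> {1..J}" for j
  proof
    assume "c j \<le> x" with j show "j \<le> Max ?S" by (intro Max_ge) auto
  next
    assume "j \<le> Max ?S"
    then have "c j \<le> c (Max ?S)"
      using assms(1) j k by (auto simp: grid_def intro: strict_mono_on_leD)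
    with k show "c j \<le> x" by auto
  qed
  with k that show ?thesis by blast
qed

lemma grid_le_iff:
  assumes "grid J c" "i \<in> {1..J}" "j \<in> {1..J}"
  shows "c i \<le> c j \<longleftrightarrow> i \<le> j"
  using assms by (auto simp: grid_def strict_mono_on_less_eq)

lemma grid_in_Omega:
  assumes "grid J c" "i \<in> {1..J}"
  shows "c i \<in> \<Omega>"
  using grid_le_iff[OF assms(1), of 1 i] grid_le_iff[OF assms(1), of i J] assms
  by (auto simp: grid_def)

text \<open>This turns the equation at a point between two states into one with the coefficients of
  the linear program.\<close>

lemma row_df_index:
  assumes "k \<le> J" and "\<And>j. j \<in> {1..J} \<Longrightarrow> c j \<le> x \<longleftrightarrow> j \<le> k"
  shows "row_df J c Q x i = (\<Sum>s=1..k. Q i s)"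
proof -
  have "row_df J c Q x i = (\<Sum>j\<in>{1..J}. if j \<le> k then Q i j else 0)"
    unfolding row_df_def by (intro sum.cong refl) (use assms(2) in auto)
  also have "\<dots> = (\<Sum>s\<in>{1..k}. Q i s)"
    using assms(1) by (intro sum.mono_neutral_cong_right) auto
  finally show ?thesis .
qed

text \<open>As \<open>N\<close> is carried by \<open>\<Omega>\<close>, the intersection loses no
  mass. The first cell is a half-line, so a possible atom at 0 is counted there.\<close>

lemma measure_cell_Omega:
  assumes "grid J c" and "i \<in> {1..J}" and "real_distribution N" and "measure N \<Omega> = 1"
  shows "measure N (\<Omega> \<inter> cell c i) = cdf N (c i) - (if i = 1 then 0 else cdf N (c (i - 1)))"
proof -
  interpret real_distribution N by fact
  have "measure N (\<Omega> \<inter> cell c i) = measure N (cell c i)"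
    using assms(4) AE_in_set_eq_1[of \<Omega>] by (intro finite_measure_eq_AE) auto
  also have "\<dots> = cdf N (c i) - (if i = 1 then 0 else cdf N (c (i - 1)))"
  proof (cases "i = 1")
    case False
    have "c (i - 1) < c i"
      using grid_le_iff[OF assms(1), of i "i - 1"] assms(2) False by fastforce
    then show ?thesis using False by (simp add: cell_def cdf_diff_eq)
  qed (simp add: cell_def cdf_def)
  finally show ?thesis .
qed

lemma discrete_df_grid:
  assumes "grid J c" and "i \<in> {1..J}"
  shows "discrete_df J c \<pi> (c i) = (\<Sum>s=1..i. \<pi> s)"
  \<comment> \<open>The vector \<open>\<pi>\<close> is treated as a row of the matrix all of whose
    rows are \<open>\<pi>\<close>.\<close>
  using row_df_index[of i J c "c i" "\<lambda>_. \<pi>" 0] grid_le_iff[OF assms(1) _ assms(2)] assms(2)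
  by (simp add: discrete_df_def row_df_def)

text \<open>A real supremum bounds its family only if the family is bounded; the crude bound
  \<open>1 + J\<close> suffices.\<close>

lemma kernel_error_bound:
  assumes kernel: "markov_kernel \<kappa>" and Q: "transition_matrix J Q" and "x \<in> \<Omega>" "u \<in> \<Omega>"
  shows "\<bar>\<kappa> x u - approx_kernel J c Q x u\<bar> \<le> kernel_error \<kappa> (approx_kernel J c Q)"
proof -
  have "\<bar>\<kappa> x u - approx_kernel J c Q x u\<bar> \<le> 1 + J" if "x \<in> \<Omega>" "u \<in> \<Omega>" for x u
  proof -
    have "(\<lambda>x. \<kappa> x u) \<in> dist_funs" using kernel that by (auto simp: markov_kernel_def)
    then have "0 \<le> \<kappa> x u" "\<kappa> x u \<le> 1" by (auto dest: dist_funs_bounds)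
    moreover have "0 \<le> approx_kernel J c Q x u"
      unfolding approx_kernel_eq using row_df_bounds[OF Q] by (intro sum_nonneg) auto
    moreover have "approx_kernel J c Q x u \<le> (\<Sum>i=1..J. 1)"
      unfolding approx_kernel_eq using row_df_bounds[OF Q]
      by (intro sum_mono) (auto simp: indicator_def)
    ultimately show ?thesis by auto
  qed
  then have "bdd_above ((\<lambda>(x, u). \<bar>\<kappa> x u - approx_kernel J c Q x u\<bar>) ` (\<Omega> \<times> \<Omega>))"
    by (intro bdd_aboveI[of _ "1 + real J"]) auto
  from cSUP_upper[OF _ this, of "(x, u)"] assms(3,4) show ?thesis
    by (simp add: kernel_error_def)
qed

text \<open>Integrating the approximate kernel against \<open>p\<close> weights the rows with the
  cell masses \<open>d i - d (i - 1) + \<pi> i\<close>. The part with \<open>\<pi>\<close> gives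
  \<open>discrete_df J c \<pi> x\<close> by stationarity. Subtracting this integral from the
  equation for \<open>p\<close> leaves the integral of the kernel difference against a probability
  measure.\<close>

lemma stationary_defect:
  assumes kernel: "markov_kernel \<kappa>" and Q: "transition_matrix J Q" and grid: "grid J c"
    and p: "stationary_df \<kappa> p" and \<pi>: "stationary_vector J Q \<pi>" and x: "x \<in> \<Omega>"
    and d: "d 0 = 0" "\<And>j. j \<in> {1..J} \<Longrightarrow> d j = p (c j) - discrete_df J c \<pi> (c j)"
  shows "\<bar>p x - discrete_df J c \<pi> x - (\<Sum>i=1..J. row_df J c Q x i * (d i - d (i - 1)))\<bar>
           \<le> kernel_error \<kappa> (approx_kernel J c Q)" (is "_ \<le> ?e")
proof -
  let ?k = "approx_kernel J c Q x"
  obtain N where N: "real_distribution N" "interval_measure p = N" "cdf N = p" "measure N \<Omega> = 1"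
    using dist_funsE p unfolding stationary_df_def by metis
  interpret N: real_distribution N by fact
  have kb: "0 \<le> \<kappa> x u" "\<kappa> x u \<le> 1" if "u \<in> \<Omega>" for u
    using kernel x that dist_funs_bounds[of "\<lambda>x. \<kappa> x u" x] by (auto simp: markov_kernel_def)
  have int: "set_integrable N \<Omega> (\<kappa> x)"
    unfolding set_integrable_def
  proof (rule N.integrable_const_bound[where B = 1])
    have "\<kappa> x \<in> borel_measurable (restrict_space borel \<Omega>)"
      using kernel x by (auto simp: markov_kernel_def)
    then show "(\<lambda>u. indicat_real \<Omega> u *\<^sub>R \<kappa> x u) \<in> borel_measurable N"
      by (subst (asm) borel_measurable_restrict_space_iff) (auto simp: mult.commute)
  qed (use kb in \<open>auto simp: indicator_def\<close>)
  have ind: "set_integrable N \<Omega> (\<lambda>u. row_df J c Q x i * indicator (cell c i) u)" for i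
    unfolding set_integrable_def
    by (rule N.integrable_const_bound[where B = "\<bar>row_df J c Q x i\<bar>"])
       (auto simp: indicator_def)
  have int': "set_integrable N \<Omega> ?k"
    unfolding approx_kernel_eq using ind
    by (simp only: set_integrable_def scaleR_sum_right) (rule Bochner_Integration.integrable_sum)
  have "(LINT u:\<Omega>|N. ?k u) = (\<Sum>i=1..J. LINT u:\<Omega>|N. row_df J c Q x i * indicator (cell c i) u)"
    unfolding approx_kernel_eq using ind
    by (simp only: set_integrable_def set_lebesgue_integral_def scaleR_sum_right)
       (rule Bochner_Integration.integral_sum)
  also have "\<dots> = (\<Sum>i=1..J. row_df J c Q x i * measure N (\<Omega> \<inter> cell c i))"
  proof (intro sum.cong refl)
    fix i
    have "(LINT u:\<Omega>|N. row_df J c Q x i * indicator (cell c i) u)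
        = (LINT u|N. row_df J c Q x i * indicator (\<Omega> \<inter> cell c i) u)"
      unfolding set_lebesgue_integral_def
      by (intro Bochner_Integration.integral_cong) (auto simp: indicator_def)
    then show "(LINT u:\<Omega>|N. row_df J c Q x i * indicator (cell c i) u)
        = row_df J c Q x i * measure N (\<Omega> \<inter> cell c i)" by simp
  qed
  finally have "(LINT u:\<Omega>|N. ?k u) = (\<Sum>i=1..J. row_df J c Q x i * measure N (\<Omega> \<inter> cell c i))" .
  \<comment> \<open>For \<open>i = 1\<close> the value \<open>d 0 = 0\<close> acts as the difference
    of the two distribution functions at \<open>c\<^sub>0 = -\<infinity>\<close>.\<close>
  moreover have "measure N (\<Omega> \<inter> cell c i) = d i - d (i - 1) + \<pi> i" if i: "i \<in> {1..J}" for i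
  proof (cases "i = 1")
    case True
    then show ?thesis
      using measure_cell_Omega[OF grid i N(1,4)] d i discrete_df_grid[OF grid i] by (simp add: N(3))
  next
    case False
    with i obtain i' where i': "i = Suc i'" "i' \<in> {1..J}" by (cases i) auto
    then show ?thesis
      using measure_cell_Omega[OF grid i N(1,4)] d(2)[OF i] d(2)[OF i'(2)]
        discrete_df_grid[OF grid i] discrete_df_grid[OF grid i'(2)] by (simp add: N(3))
  qed
  ultimately have "(LINT u:\<Omega>|N. ?k u)
      = (\<Sum>i=1..J. row_df J c Q x i * (d i - d (i - 1))) + (\<Sum>i=1..J. row_df J c Q x i * \<pi> i)"
    by (simp add: distrib_left sum.distrib)
  moreover have "(\<Sum>i=1..J. row_df J c Q x i * \<pi> i) = discrete_df J c \<pi> x"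
  proof -
    have "discrete_df J c \<pi> x = (\<Sum>j=1..J. of_bool (c j \<le> x) * (\<Sum>i=1..J. \<pi> i * Q i j))"
      unfolding discrete_df_def using \<pi> by (intro sum.cong) (auto simp: stationary_vector_def)
    also have "\<dots> = (\<Sum>i=1..J. row_df J c Q x i * \<pi> i)"
      unfolding row_df_def sum_distrib_left sum_distrib_right
      by (subst sum.swap) (simp add: ac_simps)
    finally show ?thesis ..
  qed
  moreover have "p x = (LINT u:\<Omega>|N. \<kappa> x u)"
    using p x N(2) by (simp add: stationary_df_def stieltjes_integral_def)
  ultimately have "p x - discrete_df J c \<pi> x - (\<Sum>i=1..J. row_df J c Q x i * (d i - d (i - 1)))
      = (LINT u:\<Omega>|N. \<kappa> x u - ?k u)"
    using set_integral_diff(2)[OF int int'] by simp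
  also have "\<bar>\<dots>\<bar> \<le> (LINT u|N. ?e)"
    unfolding set_lebesgue_integral_def
  proof (rule order_trans[OF integral_abs_bound], rule integral_mono)
    \<comment> \<open>Needed for \<open>u\<close> outside \<open>\<Omega>\<close>, where the
      integrand is 0.\<close>
    have "0 \<le> ?e"
      using kernel_error_bound[OF kernel Q x x, of c] by linarith
    then show "\<bar>indicat_real \<Omega> u *\<^sub>R (\<kappa> x u - ?k u)\<bar> \<le> ?e" for u
      using kernel_error_bound[OF kernel Q x, of u c] by (auto simp: indicator_def)
  qed (use set_integral_diff(1)[OF int int'] in \<open>auto simp: set_integrable_def\<close>)
  finally show ?thesis using N.prob_space by simp
qed

section \<open>Comparison of the supremum distance with the linear programs\<close>

theorem theorem1:
  fixes \<kappa> :: "real \<Rightarrow> real \<Rightarrow> real" and p p' :: "real \<Rightarrow> real"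
    and J :: nat and c :: "nat \<Rightarrow> real" and Q :: "nat \<Rightarrow> nat \<Rightarrow> real" and \<pi> :: "nat \<Rightarrow> real"
  assumes kernel: "markov_kernel \<kappa>"
    and bounded_variation: "(SUP x\<in>\<Omega>. total_variation (\<kappa> x) 0 1) < \<infinity>"
    and stationary_p: "stationary_df \<kappa> p"
    and states: "grid J c"
    and matrix: "transition_matrix J Q"
    and irreducible: "irreducible_chain J Q"
    and stationary_pi: "stationary_vector J Q \<pi>"
    and p': "p' = discrete_df J c \<pi>"
  shows "sup_norm (\<lambda>x. p x - p' x)
           \<le> kernel_error \<kappa> (approx_kernel J c Q) * stability_factor J Q"
proof -
  define D where "D = sup_norm (\<lambda>x. p x - p' x)"
  define e where "e = kernel_error \<kappa> (approx_kernel J c Q)"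
  define m where "m = Min (lp_value J Q ` {0..J})"
  define d where "d j = (if j = 0 then 0 else p (c j) - p' (c j))" for j
  have m_le: "m \<le> lp_value J Q k" if "k \<le> J" for k
    using that by (auto simp: m_def)
  \<comment> \<open>Without positivity the junk value \<open>inverse 0 = 0\<close> would make the claim too strong.\<close>
  have "m \<in> lp_value J Q ` {0..J}" unfolding m_def by (intro Min_in) auto
  then have m_pos: "0 < m" using lp_value_pos[OF matrix irreducible] by auto
  have pD: "p \<in> dist_funs" using stationary_p by (simp add: stationary_df_def)
  have \<pi>0: "\<And>i. i \<in> {1..J} \<Longrightarrow> 0 \<le> \<pi> i" and \<pi>1: "(\<Sum>i=1..J. \<pi> i) = 1"
    using stationary_pi unfolding stationary_vector_def by blast+
  have p'b: "0 \<le> p' x" "p' x \<le> 1" for x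
  proof -
    show "0 \<le> p' x" using \<pi>0 by (auto simp: p' discrete_df_def intro!: sum_nonneg)
    have "p' x \<le> (\<Sum>i=1..J. \<pi> i)"
      unfolding p' discrete_df_def using \<pi>0 by (intro sum_mono) auto
    then show "p' x \<le> 1" using \<pi>1 by simp
  qed
  \<comment> \<open>The value at 1 gives \<open>d J = 0\<close>, which removes the unit weights; the
    values off \<open>\<Omega>\<close> confine near-maximal points to
    \<open>\<Omega>\<close>.\<close>
  have outside: "p x - p' x = 0" if "x \<notin> \<Omega> \<or> x = 1" for x
  proof (cases "x < 0")
    case True
    have "p' x = 0"
      unfolding p' discrete_df_def using True grid_in_Omega[OF states]
      by (intro sum.neutral) force
    with True dist_funs_bounds(3)[OF pD] show ?thesis by simp
  next
    case False
    then have x: "1 \<le> x" using that by auto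
    have "p' x = (\<Sum>i=1..J. \<pi> i)"
      unfolding p' discrete_df_def
    proof (intro sum.cong refl)
      fix j assume "j \<in> {1..J}"
      then have "c j \<le> x" using grid_in_Omega[OF states, of j] x by simp
      then show "of_bool (c j \<le> x) * \<pi> j = \<pi> j" by simp
    qed
    with \<pi>1 x dist_funs_bounds(4)[OF pD] show ?thesis by simp
  qed
  have bound1: "\<bar>p x - p' x\<bar> \<le> 1" for x
    using dist_funs_bounds(1,2)[OF pD, of x] p'b[of x] by linarith
  then have bdd: "bdd_above (range (\<lambda>x. \<bar>p x - p' x\<bar>))"
    by (intro bdd_aboveI[of _ 1]) auto
  have leD: "\<bar>p x - p' x\<bar> \<le> D" for x
    unfolding D_def sup_norm_def by (rule cSUP_upper[OF _ bdd]) simp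
  have d_le: "\<bar>d j\<bar> \<le> D" for j
    using leD[of "c j"] leD[of 0] by (auto simp: d_def)
  have dJ: "d J = 0" using outside[of 1] states by (auto simp: d_def grid_def)
  have e_nonneg: "0 \<le> e"
    using kernel_error_bound[OF kernel matrix, of 0 0 c] by (auto simp: e_def)
  have defect: "\<bar>p x - p' x - (\<Sum>i=1..J. row_df J c Q x i * (d i - d (i - 1)))\<bar> \<le> e" if "x \<in> \<Omega>" for x
    unfolding e_def p'
    by (rule stationary_defect[OF kernel matrix states stationary_p stationary_pi that])
       (auto simp: d_def p')
  have "D * m \<le> e"
  proof (cases "D = 0")
    case False
    then have D: "0 < D" using leD[of 0] by linarith
    \<comment> \<open>The difference has jumps, so its supremum may be approached without being
      attained; hence the slack \<open>\<epsilon>\<close>.\<close>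
    have "D * m \<le> e + \<epsilon>" if \<epsilon>: "0 < \<epsilon>" for \<epsilon>
    proof -
      \<comment> \<open>The maximum with 0 ensures \<open>p x \<noteq> p' x\<close>, so that
        \<open>x\<close> lies in \<open>\<Omega>\<close> and the sign \<open>\<sigma>\<close> is 1
        or -1.\<close>
      have "max 0 (D - \<epsilon>) < D" using D \<epsilon> by simp
      also have "D = (SUP x. \<bar>p x - p' x\<bar>)" by (simp add: D_def sup_norm_def)
      finally obtain x where x: "max 0 (D - \<epsilon>) < \<bar>p x - p' x\<bar>"
        using less_cSUP_iff[OF UNIV_not_empty bdd] by blast
      then have x\<Omega>: "x \<in> \<Omega>" using outside[of x] by fastforce
      then obtain k where k: "k \<in> {1..J}" "\<And>j. j \<in> {1..J} \<Longrightarrow> c j \<le> x \<longleftrightarrow> j \<le> k"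
        using grid_index[OF states] by (metis atLeastAtMost_iff)
      define \<sigma> where "\<sigma> = sgn (p x - p' x)"
      have \<sigma>: "\<bar>\<sigma>\<bar> = 1" "\<sigma> * (p x - p' x) = \<bar>p x - p' x\<bar>"
        using x by (auto simp: \<sigma>_def abs_sgn_eq abs_sgn mult.commute)
      then have \<sigma>\<sigma>: "\<sigma> * \<sigma> = 1" by (metis abs_mult_self_eq mult_1)
      define a where "a j = \<sigma> * d j / D" for j
      have a0: "a 0 = 0" by (simp add: a_def d_def)
      have res: "residual J Q a j t = \<sigma> / D * (\<sigma> * D * t - (\<Sum>i=1..J. (\<Sum>s=1..j. Q i s) * (d i - d (i - 1))))"
        for j t
      proof -
        have "\<sigma> / D * (\<sigma> * D * t) = t" using \<sigma>\<sigma> D by simp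
        moreover have "(\<Sum>i=1..J. (\<Sum>s=1..j. Q i s) * (a i - a (i - 1)))
            = \<sigma> / D * (\<Sum>i=1..J. (\<Sum>s=1..j. Q i s) * (d i - d (i - 1)))"
          unfolding sum_distrib_left[of "\<sigma> / D"]
          by (intro sum.cong refl) (simp add: a_def diff_divide_distrib algebra_simps)
        moreover have "a J = 0" by (simp add: a_def dJ)
        ultimately show ?thesis
          by (simp add: residual_unit_split[where a = a, OF a0] right_diff_distrib)
      qed
      \<comment> \<open>Since \<open>\<bar>\<sigma> / D\<bar> = 1 / D\<close>, each constraint
        reduces to an estimate for \<open>d\<close> before normalisation.\<close>
      have bound: "\<bar>residual J Q a j t\<bar> \<le> (e + \<epsilon>) / D"
        if "\<bar>\<sigma> * D * t - (\<Sum>i=1..J. (\<Sum>s=1..j. Q i s) * (d i - d (i - 1)))\<bar> \<le> e + \<epsilon>" for j t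
        using that D \<sigma>(1) by (simp add: res abs_mult divide_right_mono)
      have "lp_feasible J Q k ((e + \<epsilon>) / D) a"
        unfolding lp_feasible_iff
      proof (intro conjI ballI impI bound)
        show "a 0 = 0" by (rule a0)
        show "\<bar>a j\<bar> \<le> 1" for j
          using d_le[of j] D \<sigma>(1) by (simp add: a_def abs_mult)
        have \<sigma>D: "\<sigma> * D * a j = d j" for j
          using \<sigma>\<sigma> D by (simp add: a_def flip: mult.assoc)
        show "\<bar>\<sigma> * D * a j - (\<Sum>i=1..J. (\<Sum>s=1..j. Q i s) * (d i - d (i - 1)))\<bar> \<le> e + \<epsilon>"
          if "j \<in> {0..J}" for j
        \<comment> \<open>Index 0 belongs to no state, and its constraint is trivial since both
          sides of the difference are 0. The others are the error equation at
          \<open>c j\<close>.\<close>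
        proof (cases "j = 0")
          case True
          then show ?thesis using e_nonneg \<epsilon> by (simp add: a0)
        next
          case False
          with that have j: "j \<in> {1..J}" by simp
          have "row_df J c Q (c j) i = (\<Sum>s=1..j. Q i s)" for i
            using j by (intro row_df_index) (auto simp: grid_le_iff[OF states])
          then show ?thesis
            using defect[OF grid_in_Omega[OF states j]] \<epsilon> False by (simp add: \<sigma>D d_def)
        qed
        have "row_df J c Q x i = (\<Sum>s=1..k. Q i s)" for i
          using k by (intro row_df_index) auto
        with defect[OF x\<Omega>]
        have 1: "\<bar>p x - p' x - (\<Sum>i=1..J. (\<Sum>s=1..k. Q i s) * (d i - d (i - 1)))\<bar> \<le> e" by simp
        \<comment> \<open>For \<open>t = 1\<close> the error equation at \<open>x\<close> is used
          with \<open>\<sigma> * D\<close> in place of \<open>p x - p' x\<close>; by the choice of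
          \<open>x\<close> this costs at most \<open>\<epsilon>\<close>.\<close>
        have "\<bar>\<sigma> * D - (p x - p' x)\<bar> = \<bar>\<sigma> * (\<sigma> * D - (p x - p' x))\<bar>"
          using \<sigma>(1) by (simp add: abs_mult)
        also have "\<sigma> * (\<sigma> * D - (p x - p' x)) = D - \<bar>p x - p' x\<bar>"
          using \<sigma>\<sigma> \<sigma>(2) by (simp add: right_diff_distrib flip: mult.assoc)
        also have "\<bar>\<dots>\<bar> \<le> \<epsilon>" using leD[of x] x by auto
        finally show "\<bar>\<sigma> * D * 1 - (\<Sum>i=1..J. (\<Sum>s=1..k. Q i s) * (d i - d (i - 1)))\<bar> \<le> e + \<epsilon>"
          using 1 by simp
      qed
      then have "m \<le> (e + \<epsilon>) / D" using m_le[of k] k(1) lp_value_le by fastforce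
      then show ?thesis using D by (simp add: field_simps)
    qed
    then show ?thesis by (rule field_le_epsilon)
  qed (use e_nonneg in simp)
  then have "D \<le> e * inverse m" using m_pos by (simp add: field_simps)
  then show ?thesis by (simp add: D_def e_def m_def stability_factor_def)
qed

end
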